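(* Let $X$ be a real Hilbert space, $\mathbb{D}\subset X$ a dictionary, and $f\in\mathcal{L}_1(\mathbb{D})$. Let $\{f_n\}_{n\ge1}$ be generated by the orthogonal greedy algorithm applied to $f$ and $\mathbb{D}$. Then for every $n\ge1$, $$\|f-f_n\|\le\frac{(n!\,V_n)^{\frac1n}}{\sqrt n}\,\|f\|_{\mathcal{L}_1(\mathbb{D})}\,\varepsilon_n(\mathrm{co}(\mathbb{D})).$$
   Context: $X$ is a real Hilbert space with inner product $\langle\cdot,\cdot\rangle$ and norm $\|\cdot\|$; a dictionary is a collection of elements of $X$. Orthogonal greedy algorithm: set $f_0=0$; for $n=1,2,\dots$ choose $g_n\in\arg\max_{g\in\mathbb{D}}|\langle g,f-f_{n-1}\rangle|$ (the maximizers are assumed to exist), set $X_n=\mathrm{span}\{g_1,\dots,g_n\}$, and let $f_n=P_{X_n}f$ be the orthogonal projection of $f$ onto $X_n$. Variation norm: $\|f\|_{\mathcal{L}_1(\mathbb{D})}=\inf\{\sum_i|c_i|:\ f=\sum_i c_ig_i,\ g_i\in\mathbb{D}\}$, and $\mathcal{L}_1(\mathbb{D})=\{f\in X:\|f\|_{\mathcal{L}_1(\mathbb{D})}<\infty\}$. Symmetric convex hull: $\mathrm{co}(\mathbb{D})=\overline{\{\sum_i c_ig_i:\ \sum_i|c_i|\le1,\ g_i\in\mathbb{D}\}}$. (Dyadic) entropy numbers: $\varepsilon_n(A)=\inf\{\varepsilon>0:\ A\text{ is covered by }2^n\text{ balls of }X\text{ of radius }\varepsilon\}$, with $\inf\emptyset=+\infty$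 (in which case the right-hand side of the estimate is read as $+\infty$ and the estimate is vacuous). $V_n=\pi^{n/2}/\Gamma(\frac n2+1)$ is the volume of the Euclidean unit ball in $\mathbb{R}^n$. *)

theory Defs
  imports "HOL-Analysis.Analysis"
begin

text \<open>Finite combinations are covered by taking almost all coefficients to be zero; infinite
  series are only required to converge in norm in the given order.\<close>

definition variation_norm :: "'a::real_inner set \<Rightarrow> 'a \<Rightarrow> ennreal" where
  "variation_norm D f =
     Inf {(\<Sum>i. ennreal \<bar>c i\<bar>) | (c :: nat \<Rightarrow> real) (g :: nat \<Rightarrow> 'a).
            (\<forall>i. c i \<noteq> 0 \<longrightarrow> g i \<in> D) \<and> (\<lambda>i. c i *\<^sub>R g i) sums f}"

definition variation_space :: "'a::real_inner set \<Rightarrow> 'a set" where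
  "variation_space D = {f. variation_norm D f < \<infinity>}"

definition symmetric_hull :: "'a::real_inner set \<Rightarrow> 'a set" where
  "symmetric_hull D =
     closure {\<Sum>i<m. c i *\<^sub>R g i | (m :: nat) (c :: nat \<Rightarrow> real) (g :: nat \<Rightarrow> 'a).
                (\<forall>i<m. g i \<in> D) \<and> (\<Sum>i<m. \<bar>c i\<bar>) \<le> 1}"

text \<open>The centres range over the whole space and may coincide. In \<^typ>\<open>ennreal\<close> the infimum of
  the empty set is \<open>\<infinity>\<close>.\<close>

definition entropy_number :: "nat \<Rightarrow> 'a::metric_space set \<Rightarrow> ennreal" where
  "entropy_number n A =
     Inf {ennreal \<epsilon> | \<epsilon>. 0 < \<epsilon> \<and> (\<exists>x :: nat \<Rightarrow> 'a. A \<subseteq> (\<Union>i<2 ^ n. cball (x i) \<epsilon>))}"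

definition is_orthogonal_projection :: "'a::real_inner set \<Rightarrow> 'a \<Rightarrow> 'a \<Rightarrow> bool" where
  "is_orthogonal_projection V x p \<longleftrightarrow> p \<in> V \<and> (\<forall>v\<in>V. orthogonal (x - p) v)"

text \<open>The maximizers need not be unique, so a run of the algorithm is a relation between the
  data \<open>D\<close>, \<open>f\<close>, the selected elements \<open>g 1, g 2, \<dots>\<close> (the value \<open>g 0\<close> is irrelevant) and the
  iterates \<open>u 0, u 1, \<dots>\<close>.\<close>

definition orthogonal_greedy ::
    "'a::real_inner set \<Rightarrow> 'a \<Rightarrow> (nat \<Rightarrow> 'a) \<Rightarrow> (nat \<Rightarrow> 'a) \<Rightarrow> bool" where
  "orthogonal_greedy D f g u \<longleftrightarrow>
     u 0 = 0 \<and>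
     (\<forall>n\<ge>1. is_arg_max (\<lambda>h. \<bar>h \<bullet> (f - u (n - 1))\<bar>) (\<lambda>h. h \<in> D) (g n) \<and>
            is_orthogonal_projection (span (g ` {1..n})) f (u n))"

end

theory Submission
  imports Defs
begin

text \<open>Let \<open>b\<^sub>k\<close> be the distance of the \<open>k\<close>-th selected element from the span of the
  earlier ones, \<open>M\<close> the variation norm of \<open>f\<close>, and \<open>r\<^sub>k\<close> the residuals. The projection step
  and the duality bound \<open>\<parallel>r\<parallel>\<^sup>2 \<le> M max |\<langle>h, r\<rangle>|\<close> show that \<open>1 / \<parallel>r\<^sub>k\<parallel>\<^sup>2\<close> grows by at least
  \<open>1 / (M b\<^sub>k)\<^sup>2\<close> in each step, so by AM-GM \<open>\<parallel>r\<^sub>n\<parallel>\<close> is at most \<open>M / sqrt n\<close> times the geometric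
  mean of the \<open>b\<^sub>k\<close>. The absolutely convex hull of the first \<open>n\<close> selected elements has
  \<open>n\<close>-dimensional volume \<open>2\<^sup>n / n! \<Prod> b\<^sub>k\<close>; if it is covered by \<open>2\<^sup>n\<close> balls of radius \<open>\<epsilon>\<close>, comparing
  volumes gives \<open>\<Prod> b\<^sub>k \<le> n! V\<^sub>n \<epsilon>\<^sup>n\<close>. The volumes are compared in the space of coefficient
  vectors \<open>c\<close>, through the triangular map sending \<open>c\<close> to the Gram-Schmidt coordinates of
  \<open>\<Sum> c\<^sub>k g\<^sub>k\<close>.\<close>

section \<open>Volumes in coefficient space\<close>

text \<open>Fubini in the last variable: once \<open>c n = y\<close> is fixed, the other coordinates
  undergo the smaller triangular map shifted by \<open>L k n * y\<close>, which is why
  \<open>v\<close> varies in the induction. The last coordinate depends on \<open>y\<close> alone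
  and is a one-dimensional affine substitution.\<close>

lemma nn_integral_triangular:
  fixes L :: "nat \<Rightarrow> nat \<Rightarrow> real" and v :: "nat \<Rightarrow> real"
  assumes "\<And>k. k < n \<Longrightarrow> L k k \<noteq> 0"
    and "F \<in> borel_measurable (Pi\<^sub>M {..<n} (\<lambda>_. lborel))"
  shows "ennreal (\<Prod>k<n. \<bar>L k k\<bar>) *
      (\<integral>\<^sup>+c. F (\<lambda>k\<in>{..<n}. v k + (\<Sum>j\<in>{k..<n}. L k j * c j)) \<partial>Pi\<^sub>M {..<n} (\<lambda>_. lborel)) =
    (\<integral>\<^sup>+x. F x \<partial>Pi\<^sub>M {..<n} (\<lambda>_. lborel))"
  using assms
proof (induction n arbitrary: F v)
  case 0
  then show ?case by (simp add: PiM_empty nn_integral_count_space_finite restrict_def)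
next
  case (Suc n)
  interpret product_sigma_finite "\<lambda>_::nat. lborel :: real measure" by standard
  let ?M = "\<lambda>n. Pi\<^sub>M {..<n::nat} (\<lambda>_. lborel :: real measure)"
  let ?T = "\<lambda>n v c. \<lambda>k\<in>{..<n}. v k + (\<Sum>j\<in>{k..<n}. L k j * c j)"
  let ?p = "\<Prod>k<n. \<bar>L k k\<bar>"
  have T_meas: "?T (Suc n) v \<in> ?M (Suc n) \<rightarrow>\<^sub>M ?M (Suc n)"
  proof (rule measurable_restrict)
    fix k
    show "(\<lambda>c. v k + (\<Sum>j\<in>{k..<Suc n}. L k j * c j)) \<in> ?M (Suc n) \<rightarrow>\<^sub>M lborel"
      by measurable
  qed
  have FT_meas: "(\<lambda>c. F (?T (Suc n) v c)) \<in> borel_measurable (?M (Suc n))"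
    by (rule measurable_compose[OF T_meas Suc.prems(2)])
  have upd: "?T (Suc n) v (c(n := y)) = (?T n (\<lambda>k. v k + L k n * y) c)(n := v n + L n n * y)" for c y
  proof
    fix k
    consider "k < n" | "k = n" | "k > n" by linarith
    then show "?T (Suc n) v (c(n := y)) k = ((?T n (\<lambda>k. v k + L k n * y) c)(n := v n + L n n * y)) k"
    proof cases
      case 1
      have "(\<Sum>j\<in>{k..<n}. L k j * (c(n := y)) j) = (\<Sum>j\<in>{k..<n}. L k j * c j)"
        by (intro sum.cong) auto
      with 1 show ?thesis by (simp add: sum.atLeastLessThan_Suc)
    qed auto
  qed
  have fubini: "(\<integral>\<^sup>+c. F (?T (Suc n) v c) \<partial>?M (Suc n)) =
      (\<integral>\<^sup>+y. \<integral>\<^sup>+c. F (?T (Suc n) v (c(n := y))) \<partial>?M n \<partial>lborel)"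
    using FT_meas unfolding lessThan_Suc by (intro product_nn_integral_insert_rev) simp_all
  have "ennreal ?p * (\<integral>\<^sup>+y. \<integral>\<^sup>+c. F (?T (Suc n) v (c(n := y))) \<partial>?M n \<partial>lborel) =
      (\<integral>\<^sup>+y. ennreal ?p * (\<integral>\<^sup>+c. F (?T (Suc n) v (c(n := y))) \<partial>?M n) \<partial>lborel)"
  proof (rule nn_integral_cmult[symmetric])
    have "(\<lambda>x. F (?T (Suc n) v ((snd x)(n := fst x)))) \<in> borel_measurable (lborel \<Otimes>\<^sub>M ?M n)"
    proof (rule measurable_compose[OF _ FT_meas])
      show "(\<lambda>x. (snd x)(n := fst x)) \<in> lborel \<Otimes>\<^sub>M ?M n \<rightarrow>\<^sub>M ?M (Suc n)"
        unfolding lessThan_Suc by measurable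
    qed
    then show "(\<lambda>y. \<integral>\<^sup>+c. F (?T (Suc n) v (c(n := y))) \<partial>?M n) \<in> borel_measurable lborel"
      by (intro sigma_finite_measure.borel_measurable_nn_integral[OF sigma_finite])
        (simp_all add: case_prod_beta')
  qed
  also have "\<dots> = (\<integral>\<^sup>+y. \<integral>\<^sup>+x. F (x(n := v n + L n n * y)) \<partial>?M n \<partial>lborel)"
  proof (rule nn_integral_cong)
    fix y :: real
    have "(\<lambda>x. x(n := v n + L n n * y)) \<in> ?M n \<rightarrow>\<^sub>M ?M (Suc n)"
      unfolding lessThan_Suc by measurable
    from measurable_compose[OF this Suc.prems(2)]
    have meas: "(\<lambda>x. F (x(n := v n + L n n * y))) \<in> borel_measurable (?M n)" .
    show "ennreal ?p * (\<integral>\<^sup>+c. F (?T (Suc n) v (c(n := y))) \<partial>?M n) =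
        (\<integral>\<^sup>+x. F (x(n := v n + L n n * y)) \<partial>?M n)"
      unfolding upd by (rule Suc.IH[OF _ meas]) (simp add: Suc.prems(1))
  qed
  finally have inner: "ennreal ?p * (\<integral>\<^sup>+c. F (?T (Suc n) v c) \<partial>?M (Suc n)) =
      (\<integral>\<^sup>+y. \<integral>\<^sup>+x. F (x(n := v n + L n n * y)) \<partial>?M n \<partial>lborel)"
    by (simp only: fubini)
  have "ennreal (\<Prod>k<Suc n. \<bar>L k k\<bar>) = ennreal \<bar>L n n\<bar> * ennreal ?p"
    by (simp add: ennreal_mult prod_nonneg mult.commute)
  then have "ennreal (\<Prod>k<Suc n. \<bar>L k k\<bar>) * (\<integral>\<^sup>+c. F (?T (Suc n) v c) \<partial>?M (Suc n)) =
      ennreal \<bar>L n n\<bar> * (\<integral>\<^sup>+y. \<integral>\<^sup>+x. F (x(n := v n + L n n * y)) \<partial>?M n \<partial>lborel)"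
    by (simp only: inner mult.assoc)
  also have "\<dots> = (\<integral>\<^sup>+y. \<integral>\<^sup>+x. F (x(n := y)) \<partial>?M n \<partial>lborel)"
  proof (rule nn_integral_real_affine[symmetric])
    have "(\<lambda>x. F ((snd x)(n := fst x))) \<in> borel_measurable (borel \<Otimes>\<^sub>M ?M n)"
    proof (rule measurable_compose[OF _ Suc.prems(2)])
      show "(\<lambda>x. (snd x)(n := fst x)) \<in> borel \<Otimes>\<^sub>M ?M n \<rightarrow>\<^sub>M ?M (Suc n)"
        unfolding lessThan_Suc by measurable
    qed
    then show "(\<lambda>y. \<integral>\<^sup>+x. F (x(n := y)) \<partial>?M n) \<in> borel_measurable borel"
      by (intro sigma_finite_measure.borel_measurable_nn_integral[OF sigma_finite])
        (simp_all add: case_prod_beta')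
  qed (use Suc.prems in auto)
  also have "\<dots> = (\<integral>\<^sup>+x. F x \<partial>?M (Suc n))"
    using Suc.prems(2) unfolding lessThan_Suc
    by (intro product_nn_integral_insert_rev[symmetric]) simp_all
  finally show ?case .
qed

text \<open>The slice at last coordinate \<open>y\<close> is the same body one dimension lower with
  radius \<open>t - \<bar>y\<bar>\<close>; hence \<open>t\<close> varies in the induction, and the
  volume is the integral of \<open>(2 * (t - \<bar>y\<bar>)) ^ n / fact n\<close>.\<close>

lemma emeasure_cross_polytope:
  assumes "t \<ge> 0"
  shows "emeasure (Pi\<^sub>M {..<n} (\<lambda>_. lborel)) {c \<in> space (Pi\<^sub>M {..<n} (\<lambda>_. lborel)). (\<Sum>i<n. \<bar>c i\<bar>) \<le> t}
    = ennreal ((2 * t) ^ n / fact n)"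
  using assms
proof (induction n arbitrary: t)
  case 0
  then show ?case by (simp add: PiM_empty)
next
  case (Suc n)
  interpret product_sigma_finite "\<lambda>_::nat. lborel :: real measure" by standard
  let ?M = "\<lambda>n. Pi\<^sub>M {..<n::nat} (\<lambda>_. lborel :: real measure)"
  let ?C = "\<lambda>n t. {c \<in> space (?M n). (\<Sum>i<n. \<bar>c i\<bar>) \<le> t}"
  let ?h = "\<lambda>y. (2 * (t - \<bar>y\<bar>)) ^ n / fact n"
  have meas [measurable]: "?C n t \<in> sets (?M n)" for n t by measurable
  have "emeasure (?M (Suc n)) (?C (Suc n) t) = (\<integral>\<^sup>+c. indicator (?C (Suc n) t) c \<partial>?M (Suc n))"
    by (subst nn_integral_indicator) auto
  also have "\<dots> = (\<integral>\<^sup>+y. \<integral>\<^sup>+c. indicator (?C (Suc n) t) (c(n := y)) \<partial>?M n \<partial>lborel)"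
    using meas[of "Suc n" t] unfolding lessThan_Suc by (intro product_nn_integral_insert_rev) auto
  also have "\<dots> = (\<integral>\<^sup>+y. ennreal (?h y) * indicator {-t..t} y \<partial>lborel)"
  proof (rule nn_integral_cong)
    fix y :: real
    have eq: "indicator (?C (Suc n) t) (c(n := y)) =
        (indicator (?C n (t - \<bar>y\<bar>)) c :: ennreal)" if "c \<in> space (?M n)" for c
    proof -
      have "(\<Sum>i<n. \<bar>(c(n := y)) i\<bar>) = (\<Sum>i<n. \<bar>c i\<bar>)" by (intro sum.cong) auto
      with that show ?thesis
        by (auto simp: indicator_def space_PiM PiE_def extensional_def)
    qed
    have "(\<integral>\<^sup>+c. indicator (?C (Suc n) t) (c(n := y)) \<partial>?M n) =
        (\<integral>\<^sup>+c. indicator (?C n (t - \<bar>y\<bar>)) c \<partial>?M n)"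
      by (rule nn_integral_cong) (rule eq)
    also have "\<dots> = emeasure (?M n) (?C n (t - \<bar>y\<bar>))"
      by (rule nn_integral_indicator) (rule meas)
    also have "\<dots> = ennreal (?h y) * indicator {-t..t} y"
    proof (cases "\<bar>y\<bar> \<le> t")
      case True
      then show ?thesis by (subst Suc.IH) (auto simp: indicator_def)
    next
      case False
      then have "(\<Sum>i<n. \<bar>c i\<bar>) > t - \<bar>y\<bar>" for c :: "nat \<Rightarrow> real"
        by (smt (verit) sum_nonneg abs_ge_zero)
      then have "?C n (t - \<bar>y\<bar>) = {}" by (auto simp: not_le)
      with False show ?thesis by (simp only: emeasure_empty) (auto simp: indicator_def)
    qed
    finally show "(\<integral>\<^sup>+c. indicator (?C (Suc n) t) (c(n := y)) \<partial>?M n) =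
      ennreal (?h y) * indicator {-t..t} y" .
  qed
  \<comment> \<open>Splitting at 0 removes the absolute value: the two intervals share only the null
    set \<open>{0}\<close>, and a reflection shows both halves equal.\<close>
  also have "\<dots> = (\<integral>\<^sup>+y. ennreal (?h y) * indicator {-t..0} y + ennreal (?h y) * indicator {0..t} y \<partial>lborel)"
    using Suc.prems by (intro nn_integral_cong_AE AE_I[of _ _ "{0}"]) (auto simp: indicator_def)
  also have "\<dots> = (\<integral>\<^sup>+y. ennreal (?h y) * indicator {-t..0} y \<partial>lborel)
      + (\<integral>\<^sup>+y. ennreal (?h y) * indicator {0..t} y \<partial>lborel)"
    by (rule nn_integral_add) auto
  also have "(\<integral>\<^sup>+y. ennreal (?h y) * indicator {-t..0} y \<partial>lborel) =
      (\<integral>\<^sup>+y. ennreal (?h y) * indicator {0..t} y \<partial>lborel)"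
    by (subst nn_integral_real_affine[of _ "-1" 0]) (auto simp: indicator_def intro!: nn_integral_cong)
  also have "(\<integral>\<^sup>+y. ennreal (?h y) * indicator {0..t} y \<partial>lborel) =
      (\<integral>\<^sup>+y\<in>{0..t}. ennreal ((2 * (t - y)) ^ n / fact n) \<partial>lborel)"
    by (rule nn_integral_cong) (auto simp: indicator_def)
  also have "\<dots> = ennreal (- ((2 * (t - t)) ^ Suc n / (2 * fact (Suc n)))
      - - ((2 * (t - 0)) ^ Suc n / (2 * fact (Suc n))))"
  proof (rule nn_integral_FTC_Icc)
    fix y
    have "((\<lambda>y. 2 * (t - y)) has_real_derivative -2) (at y)"
      by (auto intro!: derivative_eq_intros)
    from DERIV_cdivide[OF DERIV_minus[OF DERIV_power_Suc[OF this, of n]], of "2 * fact (Suc n)"]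
    have "((\<lambda>y. - ((2 * (t - y)) ^ Suc n) / (2 * fact (Suc n))) has_real_derivative
        - ((1 + real n) * (- 2 * (2 * (t - y)) ^ n)) / (2 * fact (Suc n))) (at y)" .
    moreover have "- ((1 + real n) * (- 2 * (2 * (t - y)) ^ n)) / (2 * fact (Suc n)) =
        (2 * (t - y)) ^ n / fact n"
      by (simp add: divide_simps)
    ultimately show "((\<lambda>y. - ((2 * (t - y)) ^ Suc n / (2 * fact (Suc n)))) has_real_derivative
        (2 * (t - y)) ^ n / fact n) (at y)"
      by (simp only: minus_divide_left)
  qed (use Suc.prems in auto)
  also have "- ((2 * (t - t)) ^ Suc n / (2 * fact (Suc n))) - - ((2 * (t - 0)) ^ Suc n / (2 * fact (Suc n)))
      = (2 * t) ^ Suc n / fact (Suc n) / 2"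
    by (simp add: mult_ac)
  also have "ennreal ((2 * t) ^ Suc n / fact (Suc n) / 2) + ennreal ((2 * t) ^ Suc n / fact (Suc n) / 2)
      = ennreal ((2 * t) ^ Suc n / fact (Suc n))"
    using Suc.prems by (simp del: power_Suc fact_Suc flip: ennreal_plus)
  finally show ?case .
qed

section \<open>Volume comparison for a covered hull\<close>

text \<open>Allowing norms below 1 admits the zero vectors that Gram-Schmidt produces from dependent
  input. For the expansion \<open>?p\<close> of \<open>y\<close> one still has
  \<open>?p \<bullet> ?p \<le> y \<bullet> ?p\<close>, and expanding the square of
  \<open>y - ?p\<close> finishes the argument.\<close>

lemma bessel_inequality:
  fixes e :: "nat \<Rightarrow> 'a::real_inner"
  assumes "\<And>i j. i \<noteq> j \<Longrightarrow> e i \<bullet> e j = 0" "\<And>i. norm (e i) \<le> 1"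
  shows "(\<Sum>k<n. (y \<bullet> e k)\<^sup>2) \<le> (norm y)\<^sup>2"
proof -
  let ?p = "\<Sum>k<n. (y \<bullet> e k) *\<^sub>R e k"
  have py: "y \<bullet> ?p = (\<Sum>k<n. (y \<bullet> e k)\<^sup>2)"
    by (simp add: inner_sum_right power2_eq_square)
  have "?p \<bullet> ?p = (\<Sum>k<n. (y \<bullet> e k) * (e k \<bullet> ?p))"
    by (simp add: inner_sum_left)
  also have "\<dots> = (\<Sum>k<n. (y \<bullet> e k)\<^sup>2 * (norm (e k))\<^sup>2)"
  proof (rule sum.cong)
    fix k assume "k \<in> {..<n}"
    have "e k \<bullet> ?p = (\<Sum>j<n. if j = k then (y \<bullet> e k) * (norm (e k))\<^sup>2 else 0)"
      unfolding inner_sum_right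
      by (rule sum.cong) (auto simp: assms(1) power2_norm_eq_inner)
    also have "\<dots> = (y \<bullet> e k) * (norm (e k))\<^sup>2" using \<open>k \<in> {..<n}\<close> by simp
    finally show "(y \<bullet> e k) * (e k \<bullet> ?p) = (y \<bullet> e k)\<^sup>2 * (norm (e k))\<^sup>2"
      by (simp add: power2_eq_square)
  qed simp
  also have "\<dots> \<le> (\<Sum>k<n. (y \<bullet> e k)\<^sup>2)"
    by (intro sum_mono mult_left_le) (auto simp: assms(2) power_le_one)
  finally have "?p \<bullet> ?p \<le> (\<Sum>k<n. (y \<bullet> e k)\<^sup>2)" .
  moreover have "0 \<le> (y - ?p) \<bullet> (y - ?p)" by simp
  then have "0 \<le> y \<bullet> y - 2 * (y \<bullet> ?p) + ?p \<bullet> ?p"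
    by (simp add: inner_diff_left inner_diff_right inner_commute)
  ultimately show ?thesis using py by (simp add: power2_norm_eq_inner)
qed

text \<open>In the coordinates \<open>c\<close>, the preimage of each ball lies in an ellipsoid
  whose volume is \<open>unit_ball_vol (real n) * \<epsilon> ^ n\<close> divided by the determinant
  of a triangular map with diagonal \<open>G k \<bullet> e k\<close>. The \<open>N\<close>
  ellipsoids contain the cross-polytope, of volume \<open>2 ^ n / fact n\<close>.\<close>

lemma prod_inner_le_of_cover:
  fixes G e x :: "nat \<Rightarrow> 'a::real_inner"
  assumes orth: "\<And>i j. i \<noteq> j \<Longrightarrow> e i \<bullet> e j = 0" "\<And>i. norm (e i) \<le> 1"
    and triangular: "\<And>j k. j < k \<Longrightarrow> G j \<bullet> e k = 0"
    and "\<epsilon> > 0"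
    and cover: "\<And>c. (\<Sum>i<n. \<bar>c i\<bar>) \<le> 1 \<Longrightarrow> (\<Sum>i<n. c i *\<^sub>R G i) \<in> (\<Union>i<N. cball (x i) \<epsilon>)"
  shows "2 ^ n / fact n * (\<Prod>k<n. \<bar>G k \<bullet> e k\<bar>) \<le> real N * (unit_ball_vol (real n) * \<epsilon> ^ n)"
proof (cases "\<exists>k<n. G k \<bullet> e k = 0")
  \<comment> \<open>The triangular map is singular here, but then the left-hand side
    vanishes.\<close>
  case True
  then have "(\<Prod>k<n. \<bar>G k \<bullet> e k\<bar>) = 0" by (auto simp: prod_zero_iff)
  moreover have "0 \<le> real N * (unit_ball_vol (real n) * \<epsilon> ^ n)" using \<open>\<epsilon> > 0\<close> by simp
  ultimately show ?thesis by (simp only: mult_zero_right)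
next
  case False
  let ?M = "Pi\<^sub>M {..<n} (\<lambda>_. lborel :: real measure)"
  \<comment> \<open>\<open>T i c\<close> lists the inner products of
    \<open>(\<Sum>j<n. c j *\<^sub>R G j) - x i\<close> with the \<open>e k\<close>; the terms with
    \<open>j < k\<close> drop out by triangularity.\<close>
  define T where "T i c = (\<lambda>k\<in>{..<n}. - (x i \<bullet> e k) + (\<Sum>j\<in>{k..<n}. (G j \<bullet> e k) * c j))" for i c
  define B where "B = {f. sqrt (\<Sum>k<n. (f k)\<^sup>2) \<le> \<epsilon>} \<inter> space ?M"
  define C where "C = {c \<in> space ?M. (\<Sum>i<n. \<bar>c i\<bar>) \<le> 1}"
  define P where "P = (\<Prod>k<n. \<bar>G k \<bullet> e k\<bar>)"
  have B_meas: "B \<in> sets ?M" unfolding B_def by measurable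
  have C_meas: "C \<in> sets ?M" unfolding C_def by measurable
  have T_meas: "T i \<in> ?M \<rightarrow>\<^sub>M ?M" for i
    unfolding T_def
  proof (rule measurable_restrict)
    fix k
    show "(\<lambda>c. - (x i \<bullet> e k) + (\<Sum>j\<in>{k..<n}. (G j \<bullet> e k) * c j)) \<in> ?M \<rightarrow>\<^sub>M lborel"
      by measurable
  qed
  have ind_meas: "(\<lambda>c. indicator B (T i c) :: ennreal) \<in> borel_measurable ?M" for i
    by (rule measurable_compose[OF T_meas borel_measurable_indicator[OF B_meas]])
  have vol: "ennreal P * (\<integral>\<^sup>+c. indicator B (T i c) \<partial>?M) = ennreal (unit_ball_vol (real n) * \<epsilon> ^ n)" for i
  proof -
    have "ennreal P * (\<integral>\<^sup>+c. indicator B (T i c) \<partial>?M) = (\<integral>\<^sup>+c. indicator B c \<partial>?M)"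
      unfolding T_def P_def using False
      by (intro nn_integral_triangular borel_measurable_indicator B_meas) simp_all
    also have "\<dots> = emeasure ?M B" by (simp add: B_meas)
    also have "\<dots> = ennreal (unit_ball_vol (real n) * \<epsilon> ^ n)"
      using emeasure_cball_aux[of "{..<n}" \<epsilon>] \<open>\<epsilon> > 0\<close> by (simp add: B_def)
    finally show ?thesis .
  qed
  \<comment> \<open>Bessel's inequality turns closeness to \<open>x i\<close> in the whole space
    into membership of \<open>T i c\<close> in the Euclidean ball, even for centres outside the span
    of the \<open>G k\<close>.\<close>
  have covered: "indicator C c \<le> (\<Sum>i<N. indicator B (T i c) :: ennreal)" if "c \<in> space ?M" for c
  proof (cases "c \<in> C")
    case True
    then obtain i where i: "i < N" "(\<Sum>i<n. c i *\<^sub>R G i) \<in> cball (x i) \<epsilon>"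
      using cover[of c] by (auto simp: C_def)
    let ?y = "(\<Sum>i<n. c i *\<^sub>R G i) - x i"
    have "T i c k = ?y \<bullet> e k" if "k < n" for k
    proof -
      have "(\<Sum>j<n. c j * (G j \<bullet> e k)) = (\<Sum>j\<in>{k..<n}. c j * (G j \<bullet> e k))"
        by (rule sum.mono_neutral_right) (auto simp: triangular)
      then show ?thesis
        using that by (simp add: T_def inner_diff_left inner_sum_left mult.commute)
    qed
    then have "(\<Sum>k<n. (T i c k)\<^sup>2) \<le> (norm ?y)\<^sup>2"
      using bessel_inequality[OF orth, where y = ?y] by simp
    also have "\<dots> \<le> \<epsilon>\<^sup>2"
      using i(2) by (intro power_mono) (simp_all add: dist_norm norm_minus_commute)
    finally have "T i c \<in> B"
      using \<open>\<epsilon> > 0\<close> measurable_space[OF T_meas that]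
      by (auto simp: B_def intro!: real_le_lsqrt sum_nonneg)
    then have "1 = (indicator B (T i c) :: ennreal)" by simp
    also have "\<dots> \<le> (\<Sum>i<N. indicator B (T i c))"
      using i(1) by (intro member_le_sum) auto
    finally show ?thesis using True by simp
  qed simp
  have P_nonneg: "P \<ge> 0" by (simp add: P_def prod_nonneg)
  have "ennreal (P * (2 ^ n / fact n)) = ennreal P * emeasure ?M C"
    using emeasure_cross_polytope[of 1 n] P_nonneg
    by (simp add: C_def ennreal_mult del: times_divide_eq_right)
  also have "emeasure ?M C = (\<integral>\<^sup>+c. indicator C c \<partial>?M)" by (simp add: C_meas)
  also have "\<dots> \<le> (\<integral>\<^sup>+c. (\<Sum>i<N. indicator B (T i c)) \<partial>?M)"
    by (intro nn_integral_mono covered)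
  also have "\<dots> = (\<Sum>i<N. \<integral>\<^sup>+c. indicator B (T i c) \<partial>?M)"
    by (intro nn_integral_sum ind_meas)
  finally have "ennreal (P * (2 ^ n / fact n)) \<le> ennreal P * (\<Sum>i<N. \<integral>\<^sup>+c. indicator B (T i c) \<partial>?M)"
    by (simp add: mult_left_mono)
  also have "\<dots> = (\<Sum>i<N. ennreal (unit_ball_vol (real n) * \<epsilon> ^ n))"
    by (simp only: sum_distrib_left vol)
  also have "\<dots> = ennreal (real N * (unit_ball_vol (real n) * \<epsilon> ^ n))"
    using \<open>\<epsilon> > 0\<close> by (simp add: ennreal_mult ennreal_of_nat_eq_real_of_nat)
  finally show ?thesis
    using \<open>\<epsilon> > 0\<close> by (simp add: ennreal_le_iff P_def mult.commute)
qed

section \<open>Gram-Schmidt for possibly dependent vectors\<close>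

text \<open>Since \<^term>\<open>sgn 0 = 0\<close>, a linearly dependent input vector contributes a zero vector.\<close>

function gram_schmidt :: "(nat \<Rightarrow> 'a::real_inner) \<Rightarrow> nat \<Rightarrow> 'a" where
  "gram_schmidt G k =
     sgn (G k - (\<Sum>j<k. (G k \<bullet> gram_schmidt G j) *\<^sub>R gram_schmidt G j))"
  by auto
termination by (relation "Wellfounded.measure snd") auto

declare gram_schmidt.simps [simp del]

text \<open>Kept before normalization because its length is the distance \<open>b\<^sub>k\<close> of
  \<open>G k\<close> from the span of its predecessors.\<close>

definition gram_schmidt_residual :: "(nat \<Rightarrow> 'a::real_inner) \<Rightarrow> nat \<Rightarrow> 'a" where
  "gram_schmidt_residual G k =
     G k - (\<Sum>j<k. (G k \<bullet> gram_schmidt G j) *\<^sub>R gram_schmidt G j)"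

lemma gram_schmidt_eq_sgn: "gram_schmidt G k = sgn (gram_schmidt_residual G k)"
  by (subst gram_schmidt.simps) (simp add: gram_schmidt_residual_def)

lemma norm_gram_schmidt: "norm (gram_schmidt G k) = (if gram_schmidt_residual G k = 0 then 0 else 1)"
  by (simp add: gram_schmidt_eq_sgn norm_sgn)

lemma residual_eq_scaleR: "gram_schmidt_residual G k = norm (gram_schmidt_residual G k) *\<^sub>R gram_schmidt G k"
  by (cases "gram_schmidt_residual G k = 0") (simp_all add: gram_schmidt_eq_sgn sgn_div_norm)

text \<open>Strong induction on the larger index: in the inner product with an earlier direction
  only the \<open>i\<close>-th term of the sum survives, and it cancels the component of
  \<open>G k\<close>.\<close>

lemma gram_schmidt_orthogonal:
  assumes "i \<noteq> j"
  shows "gram_schmidt G i \<bullet> gram_schmidt G j = 0"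
proof -
  have "\<forall>i<k. gram_schmidt G k \<bullet> gram_schmidt G i = 0" for k
  proof (induction k rule: less_induct)
    case (less k)
    let ?e = "gram_schmidt G"
    show ?case
    proof (intro allI impI)
      fix i assume "i < k"
      have "(\<Sum>j<k. (G k \<bullet> ?e j) * (?e j \<bullet> ?e i)) =
          (\<Sum>j<k. if j = i then (G k \<bullet> ?e i) * (?e i \<bullet> ?e i) else 0)"
      proof (rule sum.cong)
        fix j assume "j \<in> {..<k}"
        then show "(G k \<bullet> ?e j) * (?e j \<bullet> ?e i) =
            (if j = i then (G k \<bullet> ?e i) * (?e i \<bullet> ?e i) else 0)"
          using less.IH[of j] less.IH[of i] \<open>i < k\<close>
          by (cases j i rule: linorder_cases) (auto simp: inner_commute)
      qed simp
      also have "\<dots> = (G k \<bullet> ?e i) * (norm (?e i))\<^sup>2"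
        using \<open>i < k\<close> by (simp add: power2_norm_eq_inner)
      \<comment> \<open>\<open>?e i\<close> has norm 1 or is zero, and in the latter case both sides
        vanish.\<close>
      also have "\<dots> = G k \<bullet> ?e i"
        by (cases "gram_schmidt_residual G i = 0") (simp_all add: gram_schmidt_eq_sgn norm_sgn)
      finally have "gram_schmidt_residual G k \<bullet> ?e i = 0"
        by (simp add: gram_schmidt_residual_def inner_diff_left inner_sum_left)
      then show "?e k \<bullet> ?e i = 0"
        by (simp add: gram_schmidt_eq_sgn[of G k] sgn_div_norm)
    qed
  qed
  then show ?thesis
    using assms by (metis inner_commute linorder_neqE_nat)
qed

text \<open>\<open>G j\<close> is a combination of the directions up to \<open>j\<close>, all
  orthogonal to the \<open>k\<close>-th. This makes the coefficient map triangular.\<close>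

lemma inner_gram_schmidt_eq_zero:
  assumes "j < k"
  shows "G j \<bullet> gram_schmidt G k = 0"
proof -
  let ?e = "gram_schmidt G"
  have "gram_schmidt_residual G j \<bullet> ?e k = 0"
    using assms by (subst residual_eq_scaleR) (simp add: gram_schmidt_orthogonal)
  moreover have "(\<Sum>i<j. (G j \<bullet> ?e i) * (?e i \<bullet> ?e k)) = 0"
    using assms by (intro sum.neutral) (auto simp: gram_schmidt_orthogonal)
  ultimately show ?thesis
    by (simp add: gram_schmidt_residual_def inner_diff_left inner_sum_left)
qed

text \<open>\<open>G k\<close> differs from its residual by a combination of earlier directions. The
  values are the diagonal of the triangular map, so its determinant is the product of the
  distances.\<close>

lemma inner_gram_schmidt_self: "G k \<bullet> gram_schmidt G k = norm (gram_schmidt_residual G k)"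
proof -
  let ?e = "gram_schmidt G" and ?h = "gram_schmidt_residual G k"
  have "(\<Sum>i<k. (G k \<bullet> ?e i) * (?e i \<bullet> ?e k)) = 0"
    by (intro sum.neutral) (auto simp: gram_schmidt_orthogonal)
  then have "G k \<bullet> ?e k = ?h \<bullet> ?e k"
    by (simp add: gram_schmidt_residual_def inner_diff_left inner_sum_left)
  also have "\<dots> = norm ?h"
    by (cases "?h = 0")
      (simp_all add: gram_schmidt_eq_sgn sgn_div_norm power2_norm_eq_inner[symmetric] power2_eq_square)
  finally show ?thesis .
qed

lemma gram_schmidt_in_span: "gram_schmidt G k \<in> span (G ` {..k})"
proof (induction k rule: less_induct)
  case (less k)
  have "gram_schmidt G j \<in> span (G ` {..k})" if "j < k" for j
    using less.IH[OF that] span_mono[of "G ` {..j}" "G ` {..k}"] that by (auto simp: image_mono)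
  then show ?case
    by (subst gram_schmidt.simps)
      (auto simp: sgn_div_norm intro!: span_scale span_diff span_sum intro: span_base)
qed

section \<open>Best approximation and duality\<close>

lemma orthogonal_projection_best:
  assumes "is_orthogonal_projection (span S) f p" "v \<in> span S"
  shows "norm (f - p) \<le> norm (f - v)"
proof -
  have "p - v \<in> span S" using assms by (auto simp: is_orthogonal_projection_def intro: span_diff)
  then have "orthogonal (f - p) (p - v)" using assms by (auto simp: is_orthogonal_projection_def)
  then have "(norm (f - p + (p - v)))\<^sup>2 = (norm (f - p))\<^sup>2 + (norm (p - v))\<^sup>2"
    by (rule norm_add_Pythagorean)
  then have "(norm (f - p))\<^sup>2 \<le> (norm (f - v))\<^sup>2" by simp
  then show ?thesis by (rule power2_le_imp_le) simp
qed

text \<open>Pairing any representation of \<open>f\<close> with \<open>r\<close> bounds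
  \<open>f \<bullet> r\<close> by its coefficient sum times \<open>a\<close>; then the infimum over
  all representations is taken.\<close>

lemma variation_norm_dual:
  assumes "f \<in> variation_space D" "a \<ge> 0" "\<And>h. h \<in> D \<Longrightarrow> \<bar>h \<bullet> r\<bar> \<le> a"
  shows "f \<bullet> r \<le> enn2real (variation_norm D f) * a"
proof -
  have rep: "f \<bullet> r \<le> s * a" if "(\<Sum>i. ennreal \<bar>c i\<bar>) = ennreal s" "s \<ge> 0"
    "\<forall>i. c i \<noteq> 0 \<longrightarrow> g i \<in> D" "(\<lambda>i. c i *\<^sub>R g i) sums f" for c s and g :: "nat \<Rightarrow> 'a"
  proof (rule sums_le)
    show "(\<lambda>i. c i * (g i \<bullet> r)) sums (f \<bullet> r)"
      using bounded_linear.sums[OF bounded_linear_inner_left that(4)] by simp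
    have "summable (\<lambda>i. \<bar>c i\<bar>)"
      using that(1) by (intro summable_suminf_not_top) auto
    moreover from this have "(\<Sum>i. \<bar>c i\<bar>) = s"
      using that(1,2) by (simp add: suminf_ennreal2 suminf_nonneg)
    ultimately show "(\<lambda>i. \<bar>c i\<bar> * a) sums (s * a)"
      using sums_mult2 summable_sums by blast
    fix i
    have "c i * (g i \<bullet> r) \<le> \<bar>c i\<bar> * \<bar>g i \<bullet> r\<bar>" by (metis abs_ge_self abs_mult)
    \<comment> \<open>Where \<open>c i = 0\<close>, the vector \<open>g i\<close> may lie outside
      \<open>D\<close>, so that case is separate.\<close>
    also have "\<dots> \<le> \<bar>c i\<bar> * a"
      using assms(3) that(3) by (cases "c i = 0") (auto intro!: mult_left_mono)
    finally show "c i * (g i \<bullet> r) \<le> \<bar>c i\<bar> * a" .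
  qed
  define S where "S = {(\<Sum>i. ennreal \<bar>c i\<bar>) | (c :: nat \<Rightarrow> real) (g :: nat \<Rightarrow> 'a).
            (\<forall>i. c i \<noteq> 0 \<longrightarrow> g i \<in> D) \<and> (\<lambda>i. c i *\<^sub>R g i) sums f}"
  have norm_eq: "variation_norm D f = Inf S" by (simp add: variation_norm_def S_def)
  have finite: "variation_norm D f < \<infinity>" using assms(1) by (simp add: variation_space_def)
  have bound: "f \<bullet> r \<le> enn2real t * a" if "t \<in> S" "t < \<infinity>" for t
  proof -
    from that obtain c g where "t = (\<Sum>i. ennreal \<bar>c i\<bar>)"
      "\<forall>i. c i \<noteq> 0 \<longrightarrow> g i \<in> D" "(\<lambda>i. c i *\<^sub>R g i) sums f"
      by (auto simp: S_def)
    then show ?thesis using that(2) by (intro rep[of c _ g]) (auto simp: ennreal_enn2real_if)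
  qed
  show ?thesis
  proof (cases "a > 0")
    case True
    have "ennreal (f \<bullet> r / a) \<le> Inf S"
    proof (rule Inf_greatest)
      fix t assume "t \<in> S"
      show "ennreal (f \<bullet> r / a) \<le> t"
      proof (cases "t = \<infinity>")
        case False
        then have "f \<bullet> r / a \<le> enn2real t"
          using bound[OF \<open>t \<in> S\<close>] True by (simp add: divide_le_eq less_top)
        then have "ennreal (f \<bullet> r / a) \<le> ennreal (enn2real t)" by (rule ennreal_leI)
        also have "\<dots> = t" using False by (simp add: less_top)
        finally show ?thesis .
      qed simp
    qed
    then have "ennreal (f \<bullet> r / a) \<le> ennreal (enn2real (variation_norm D f))"
      using finite by (simp add: norm_eq less_top)
    then show ?thesis using True by (simp add: ennreal_le_iff divide_le_eq)
  next
    case False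
    \<comment> \<open>Division by \<open>a\<close> is impossible for \<open>a = 0\<close>, but one
      representation of finite cost already gives \<open>f \<bullet> r \<le> 0\<close>.\<close>
    obtain t where "t \<in> S" "t < \<infinity>" using finite by (auto simp: norm_eq Inf_less_iff)
    then show ?thesis using bound[of t] False \<open>a \<ge> 0\<close> by simp
  qed
qed

section \<open>Decay of the greedy residuals\<close>

text \<open>The algorithm counts from 1 and Gram-Schmidt from 0, hence the vectors
  \<open>g (Suc k)\<close>. The first bound is duality, as \<open>f - u k\<close> is orthogonal to
  \<open>u k\<close>. The second compares \<open>u (Suc k)\<close> with the best move from
  \<open>u k\<close> along the new direction; the factor \<open>(norm h)\<^sup>2\<close> lets it
  include \<open>h = 0\<close>.\<close>

lemma orthogonal_greedy_step:
  assumes "f \<in> variation_space D" and greedy: "orthogonal_greedy D f g u"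
    and "gram_schmidt_residual (\<lambda>k. g (Suc k)) k = h"
    and "M = enn2real (variation_norm D f)"
  shows "(norm (f - u k))\<^sup>2 \<le> M * \<bar>g (Suc k) \<bullet> (f - u k)\<bar>"
    and "(norm (f - u (Suc k)))\<^sup>2 * (norm h)\<^sup>2 + (g (Suc k) \<bullet> (f - u k))\<^sup>2 \<le> (norm (f - u k))\<^sup>2 * (norm h)\<^sup>2"
    and "norm (f - u (Suc k)) \<le> norm (f - u k)"
    and "h = 0 \<Longrightarrow> g (Suc k) \<bullet> (f - u k) = 0"
proof -
  let ?G = "\<lambda>k. g (Suc k)" and ?r = "f - u k"
  let ?e = "gram_schmidt ?G"
  have range: "g ` {1..n} = ?G ` {..<n}" for n
    by (simp add: image_image lessThan_atLeast0 flip: image_Suc_atLeastLessThan atLeastLessThanSuc_atLeastAtMost)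
  have proj: "is_orthogonal_projection (span (?G ` {..<n})) f (u n)" for n
  \<comment> \<open>The definition of a run imposes the projection only for
    \<open>n \<ge> 1\<close>; at \<open>n = 0\<close> the span is trivial and
    \<open>u 0 = 0\<close>.\<close>
  proof (cases "n = 0")
    case True
    then show ?thesis using greedy by (simp add: orthogonal_greedy_def is_orthogonal_projection_def orthogonal_def)
  next
    case False
    then have "is_orthogonal_projection (span (g ` {1..n})) f (u n)"
      using greedy by (simp add: orthogonal_greedy_def)
    then show ?thesis by (simp only: range)
  qed
  have orth: "v \<bullet> ?r = 0" if "v \<in> span (?G ` {..<k})" for v
    using proj[of k] that by (simp add: is_orthogonal_projection_def orthogonal_def inner_commute)
  have u_span: "u n \<in> span (?G ` {..<n})" for n
    using proj[of n] by (simp add: is_orthogonal_projection_def)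
  have e_span: "?e j \<in> span (?G ` {..<n})" if "j < n" for j n
    using that by (intro subsetD[OF span_mono[OF image_mono] gram_schmidt_in_span]) auto
  have max: "\<bar>h \<bullet> ?r\<bar> \<le> \<bar>?G k \<bullet> ?r\<bar>" if "h \<in> D" for h
  proof -
    have "is_arg_max (\<lambda>h. \<bar>h \<bullet> (f - u (Suc k - 1))\<bar>) (\<lambda>h. h \<in> D) (g (Suc k))"
      using greedy unfolding orthogonal_greedy_def by (metis le_add1 plus_1_eq_Suc)
    then show ?thesis using that by (auto simp: is_arg_max_linorder)
  qed
  have "f \<bullet> ?r \<le> M * \<bar>?G k \<bullet> ?r\<bar>"
    using variation_norm_dual[OF assms(1) _ max] assms(4) by simp
  moreover have "f \<bullet> ?r = (norm ?r)\<^sup>2"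
    using orth[OF u_span] by (simp add: power2_norm_eq_inner inner_diff_left)
  ultimately show "(norm ?r)\<^sup>2 \<le> M * \<bar>?G k \<bullet> ?r\<bar>" by simp
  have "u k \<in> span (?G ` {..<Suc k})"
    by (intro subsetD[OF span_mono[OF image_mono] u_span]) auto
  then show "norm (f - u (Suc k)) \<le> norm ?r"
    by (rule orthogonal_projection_best[OF proj])
  have "(\<Sum>j<k. (?G k \<bullet> ?e j) * (?e j \<bullet> ?r)) = 0"
    by (intro sum.neutral) (auto simp: orth e_span)
  then have Gh: "?G k \<bullet> ?r = h \<bullet> ?r"
    unfolding assms(3)[symmetric] gram_schmidt_residual_def
    by (simp add: inner_diff_left inner_sum_left)
  then show "h = 0 \<Longrightarrow> ?G k \<bullet> ?r = 0" by simp
  let ?t = "?e k \<bullet> ?r"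
  have h: "h = norm h *\<^sub>R ?e k" using residual_eq_scaleR[of ?G k] assms(3) by simp
  have "u k + ?t *\<^sub>R ?e k \<in> span (?G ` {..<Suc k})"
    using \<open>u k \<in> span (?G ` {..<Suc k})\<close> e_span[of k "Suc k"] by (auto intro: span_add span_scale)
  then have "norm (f - u (Suc k)) \<le> norm (f - (u k + ?t *\<^sub>R ?e k))"
    by (rule orthogonal_projection_best[OF proj])
  then have "(norm (f - u (Suc k)))\<^sup>2 \<le> (norm (?r - ?t *\<^sub>R ?e k))\<^sup>2"
    by (simp add: algebra_simps)
  also have "\<dots> = (norm ?r)\<^sup>2 - 2 * ?t\<^sup>2 + ?t\<^sup>2 * (norm (?e k))\<^sup>2"
    unfolding power2_norm_eq_inner
    by (simp add: inner_diff_left inner_diff_right inner_commute power2_eq_square)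
  also have "\<dots> \<le> (norm ?r)\<^sup>2 - ?t\<^sup>2"
    by (simp add: norm_gram_schmidt)
  finally have "((norm (f - u (Suc k)))\<^sup>2 + ?t\<^sup>2) * (norm h)\<^sup>2 \<le> (norm ?r)\<^sup>2 * (norm h)\<^sup>2"
    by (intro mult_right_mono) auto
  moreover have "?G k \<bullet> ?r = norm h * ?t"
    unfolding Gh by (subst h) simp
  ultimately show "(norm (f - u (Suc k)))\<^sup>2 * (norm h)\<^sup>2 + (?G k \<bullet> ?r)\<^sup>2 \<le> (norm ?r)\<^sup>2 * (norm h)\<^sup>2"
    by (simp only: power_mult_distrib distrib_left mult.commute)
qed

text \<open>Here \<open>a\<close> and \<open>a'\<close> are the squared residual norms before and
  after a step, \<open>p\<close> the selected inner product in absolute value and \<open>b\<close>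
  the distance of the new element. Dividing \<open>a * a' \<le> a\<^sup>2 \<le> (M * p)\<^sup>2
  \<le> M\<^sup>2 * ((a - a') * b\<^sup>2)\<close> by \<open>a * a'\<close> gives the
  growth.\<close>

lemma inverse_residual_growth:
  fixes a a' p b M :: real
  assumes "a' > 0" "a \<le> M * p" "a' * b\<^sup>2 + p\<^sup>2 \<le> a * b\<^sup>2" "b > 0" "M > 0" "a \<ge> a'"
  shows "1 / a + 1 / (M * b)\<^sup>2 \<le> 1 / a'"
proof -
  have "a > 0" using assms by linarith
  have "a * a' \<le> a\<^sup>2" using assms \<open>a > 0\<close> by (simp add: power2_eq_square mult_left_mono)
  also have "\<dots> \<le> (M * p)\<^sup>2" using assms \<open>a > 0\<close> by (intro power_mono) auto
  also have "\<dots> \<le> M\<^sup>2 * ((a - a') * b\<^sup>2)"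
    unfolding power_mult_distrib using assms(3) by (intro mult_left_mono) (simp_all add: algebra_simps)
  finally have "a * a' \<le> (a - a') * (M * b)\<^sup>2" by (simp add: power_mult_distrib algebra_simps)
  then have "1 / (M * b)\<^sup>2 \<le> (a - a') / (a * a')"
    using assms \<open>a > 0\<close> by (simp add: divide_simps)
  also have "\<dots> = 1 / a' - 1 / a" using assms \<open>a > 0\<close> by (simp add: field_simps)
  finally show ?thesis by simp
qed

text \<open>Summing the growth over the first \<open>n\<close> steps bounds the inverse squared
  residual norm from below, and AM-GM brings in the geometric mean of the \<open>b k\<close>. Since
  residual norms never increase, \<open>u n \<noteq> f\<close> keeps all earlier ones
  positive.\<close>

lemma orthogonal_greedy_gram_schmidt_bound:
  assumes "f \<in> variation_space D" and "orthogonal_greedy D f g u" and "n \<ge> 1" and "u n \<noteq> f"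
    and "M = enn2real (variation_norm D f)"
  defines "b \<equiv> \<lambda>k. norm (gram_schmidt_residual (\<lambda>k. g (Suc k)) k)"
  shows "M > 0"
    and "norm (f - u n) \<le> M / sqrt (real n) * (\<Prod>k<n. b k) powr (1 / real n)"
proof -
  let ?a = "\<lambda>k. (norm (f - u k))\<^sup>2"
  note step = orthogonal_greedy_step[OF assms(1,2) refl assms(5)]
  have "norm (f - u n) \<le> norm (f - u k)" if "k \<le> n" for k
    using that by (rule lift_Suc_antimono_le[of "\<lambda>k. norm (f - u k)", OF step(3)])
  then have a_pos: "?a k > 0" if "k \<le> n" for k
    using that \<open>u n \<noteq> f\<close> by (smt (verit) zero_less_norm_iff right_minus_eq zero_less_power)
  have "M \<ge> 0" using assms(5) by simp
  have "0 < M * \<bar>g (Suc k) \<bullet> (f - u k)\<bar>" if "k \<le> n" for k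
    using a_pos[OF that] step(1)[of k] by linarith
  then have M_p: "M > 0 \<and> g (Suc k) \<bullet> (f - u k) \<noteq> 0" if "k \<le> n" for k
    using that \<open>M \<ge> 0\<close> by (fastforce simp: zero_less_mult_iff)
  then show "M > 0" by blast
  \<comment> \<open>A selected element dependent on the earlier ones would be orthogonal to the
    residual, which \<open>M_p\<close> excludes.\<close>
  have b_pos: "b k > 0" if "k < n" for k
    using M_p[of k] step(4)[of k] that by (auto simp: b_def)
  have "(\<Sum>k<m. 1 / (M * b k)\<^sup>2) \<le> 1 / ?a m" if "m \<le> n" for m
    using that
  proof (induction m)
    case (Suc m)
    have "1 / ?a m + 1 / (M * b m)\<^sup>2 \<le> 1 / ?a (Suc m)"
    proof (rule inverse_residual_growth)
      show "?a m \<le> M * \<bar>g (Suc m) \<bullet> (f - u m)\<bar>" by (rule step(1))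
      show "?a (Suc m) * (b m)\<^sup>2 + \<bar>g (Suc m) \<bullet> (f - u m)\<bar>\<^sup>2 \<le> ?a m * (b m)\<^sup>2"
        unfolding b_def power2_abs by (rule step(2))
      show "?a (Suc m) \<le> ?a m" by (intro power_mono step(3)) simp
    qed (use Suc.prems a_pos b_pos \<open>M > 0\<close> in auto)
    with Suc show ?case by simp
  qed simp
  then have sum_le: "(\<Sum>k<n. 1 / (M * b k)\<^sup>2) \<le> 1 / ?a n" by simp
  define P where "P = (\<Prod>k<n. b k)"
  have P_pos: "P > 0" unfolding P_def using b_pos by (intro prod_pos) auto
  \<comment> \<open>\<open>q\<close> is \<open>M\<close> times the geometric mean of the
    \<open>b k\<close>, so the \<open>1 / (M * b k)\<^sup>2\<close> have geometric mean
    \<open>1 / q\<^sup>2\<close>.\<close>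
  define q where "q = M * P powr (1 / real n)"
  have q_pos: "q > 0" using P_pos \<open>M > 0\<close> by (simp add: q_def)
  have "q ^ n = M ^ n * P"
    using P_pos \<open>n \<ge> 1\<close> by (simp add: q_def power_mult_distrib powr_realpow[symmetric] powr_powr)
  then have "(\<Prod>k<n. 1 / (M * b k)\<^sup>2) = 1 / (q ^ n)\<^sup>2"
    by (simp add: prod_dividef prod_power_distrib[symmetric] prod.distrib flip: P_def)
  also have "\<dots> = (1 / q\<^sup>2) ^ n"
    by (simp add: power_divide mult.commute flip: power_mult)
  finally have "(\<Prod>k<n. 1 / (M * b k)\<^sup>2) = (1 / q\<^sup>2) ^ n" .
  moreover have "((1 / q\<^sup>2) ^ n) powr (1 / real n) = 1 / q\<^sup>2"
    using q_pos \<open>n \<ge> 1\<close> by (subst powr_realpow[symmetric]) (simp_all add: powr_powr)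
  ultimately have "1 / q\<^sup>2 \<le> (\<Sum>k<n. 1 / (M * b k)\<^sup>2 / real n)"
    using arith_geom_mean[of "{..<n}" "\<lambda>k. 1 / (M * b k)\<^sup>2"] \<open>n \<ge> 1\<close> by (simp add: lessThan_empty_iff)
  also have "\<dots> \<le> 1 / ?a n / real n"
    using divide_right_mono[OF sum_le, of "real n"] by (simp only: sum_divide_distrib of_nat_0_le_iff)
  finally have "?a n \<le> q\<^sup>2 / real n"
    using q_pos a_pos[of n] \<open>n \<ge> 1\<close> by (simp add: field_simps)
  also have "\<dots> = (q / sqrt (real n))\<^sup>2" by (simp add: power_divide)
  finally have "norm (f - u n) \<le> q / sqrt (real n)"
    by (rule power2_le_imp_le) (use q_pos in simp)
  then show "norm (f - u n) \<le> M / sqrt (real n) * (\<Prod>k<n. b k) powr (1 / real n)"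
    by (simp add: q_def P_def)
qed

section \<open>From coverings to entropy numbers\<close>

text \<open>The number \<open>2 ^ n\<close> of balls cancels the factor \<open>2 ^ n\<close> in the
  volume of the cross-polytope; the \<open>n\<close>-th root of what remains bounds the geometric
  mean of the distances.\<close>

lemma orthogonal_greedy_cover_bound:
  fixes x :: "nat \<Rightarrow> 'a::real_inner"
  assumes "f \<in> variation_space D" and greedy: "orthogonal_greedy D f g u" and "n \<ge> 1" and "u n \<noteq> f"
    and "\<epsilon> > 0" and cover: "symmetric_hull D \<subseteq> (\<Union>i<2 ^ n. cball (x i) \<epsilon>)"
  shows "norm (f - u n) \<le> (fact n * unit_ball_vol (real n)) powr (1 / real n) / sqrt (real n)
    * enn2real (variation_norm D f) * \<epsilon>"
proof -
  let ?G = "\<lambda>k. g (Suc k)" and ?M = "enn2real (variation_norm D f)"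
  let ?P = "\<Prod>k<n. norm (gram_schmidt_residual ?G k)"
  note bound = orthogonal_greedy_gram_schmidt_bound[OF assms(1-4) refl]
  have "2 ^ n / fact n * (\<Prod>k<n. \<bar>?G k \<bullet> gram_schmidt ?G k\<bar>)
      \<le> real (2 ^ n) * (unit_ball_vol (real n) * \<epsilon> ^ n)"
  proof (rule prod_inner_le_of_cover[where x = x])
    fix c :: "nat \<Rightarrow> real" assume c: "(\<Sum>i<n. \<bar>c i\<bar>) \<le> 1"
    have "?G i \<in> D" for i
    proof -
      have "is_arg_max (\<lambda>h. \<bar>h \<bullet> (f - u (Suc i - 1))\<bar>) (\<lambda>h. h \<in> D) (g (Suc i))"
        using greedy unfolding orthogonal_greedy_def by (metis le_add1 plus_1_eq_Suc)
      then show ?thesis by (simp add: is_arg_max_def)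
    qed
    with c have "(\<Sum>i<n. c i *\<^sub>R ?G i) \<in> symmetric_hull D"
      unfolding symmetric_hull_def by (intro subsetD[OF closure_subset] CollectI exI[of _ n] exI[of _ c] exI[of _ ?G]) auto
    then show "(\<Sum>i<n. c i *\<^sub>R ?G i) \<in> (\<Union>i<2 ^ n. cball (x i) \<epsilon>)" using cover by blast
  next
    fix j k :: nat assume "j < k"
    then show "?G j \<bullet> gram_schmidt ?G k = 0" by (rule inner_gram_schmidt_eq_zero)
  qed (auto simp: gram_schmidt_orthogonal norm_gram_schmidt \<open>\<epsilon> > 0\<close>)
  then have "?P \<le> (fact n * unit_ball_vol (real n)) * \<epsilon> ^ n"
    by (simp add: inner_gram_schmidt_self[of ?G] field_simps)
  then have "?P powr (1 / real n) \<le> ((fact n * unit_ball_vol (real n)) * \<epsilon> ^ n) powr (1 / real n)"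
    by (intro powr_mono2) (auto intro: prod_nonneg)
  also have "\<dots> = (fact n * unit_ball_vol (real n)) powr (1 / real n) * \<epsilon>"
    using \<open>\<epsilon> > 0\<close> \<open>n \<ge> 1\<close> by (simp add: powr_mult powr_realpow[symmetric] powr_powr)
  finally have "?M / sqrt (real n) * ?P powr (1 / real n)
      \<le> ?M / sqrt (real n) * ((fact n * unit_ball_vol (real n)) powr (1 / real n) * \<epsilon>)"
    by (intro mult_left_mono) auto
  with bound(2) show ?thesis by (simp add: mult_ac)
qed

theorem theorem4p2:
  fixes D :: "'a::{real_inner, complete_space} set"
    and f :: 'a
    and g u :: "nat \<Rightarrow> 'a"
    and n :: nat
  assumes "f \<in> variation_space D"
    and "orthogonal_greedy D f g u"
    and "n \<ge> 1"
  shows "ennreal (norm (f - u n)) \<le>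
    (if entropy_number n (symmetric_hull D) = \<infinity> then \<infinity>
     else ennreal ((fact n * unit_ball_vol (real n)) powr (1 / real n) / sqrt (real n))
            * variation_norm D f * entropy_number n (symmetric_hull D))"
\<comment> \<open>If \<open>u n = f\<close> the left-hand side is 0; otherwise \<open>M > 0\<close>,
  which permits division by \<open>K * M\<close>.\<close>
proof (cases "u n = f")
  case False
  define K where "K = (fact n * unit_ball_vol (real n)) powr (1 / real n) / sqrt (real n)"
  define M where "M = enn2real (variation_norm D f)"
  have "M > 0" using orthogonal_greedy_gram_schmidt_bound(1)[OF assms False M_def] .
  have "K > 0" using \<open>n \<ge> 1\<close> unfolding K_def by (intro divide_pos_pos) (simp_all add: less_imp_neq[symmetric])
  have M: "variation_norm D f = ennreal M"
    using assms(1) by (simp add: M_def variation_space_def less_top)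
  \<comment> \<open>The infimum need not be attained, so the bound for a single covering is recast
    as a lower bound on every admissible radius.\<close>
  have "ennreal (norm (f - u n) / (K * M)) \<le> entropy_number n (symmetric_hull D)"
    unfolding entropy_number_def
  proof (rule Inf_greatest)
    fix t :: ennreal
    assume "t \<in> {ennreal \<epsilon> |\<epsilon>. 0 < \<epsilon> \<and> (\<exists>x :: nat \<Rightarrow> 'a. symmetric_hull D \<subseteq> (\<Union>i<2 ^ n. cball (x i) \<epsilon>))}"
    then obtain \<epsilon> and x :: "nat \<Rightarrow> 'a" where t: "t = ennreal \<epsilon>" "0 < \<epsilon>"
      "symmetric_hull D \<subseteq> (\<Union>i<2 ^ n. cball (x i) \<epsilon>)" by blast
    have "norm (f - u n) \<le> K * M * \<epsilon>"
      unfolding K_def M_def by (rule orthogonal_greedy_cover_bound[OF assms False t(2,3)])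
    then show "ennreal (norm (f - u n) / (K * M)) \<le> t"
      unfolding t(1) using \<open>K > 0\<close> \<open>M > 0\<close> by (intro ennreal_leI) (simp add: field_simps)
  qed
  then have "ennreal (K * M) * ennreal (norm (f - u n) / (K * M))
      \<le> ennreal (K * M) * entropy_number n (symmetric_hull D)"
    by (rule mult_left_mono) simp
  moreover have "ennreal (K * M) * ennreal (norm (f - u n) / (K * M)) = ennreal (norm (f - u n))"
    using \<open>K > 0\<close> \<open>M > 0\<close> by (simp add: ennreal_mult[symmetric])
  moreover have "ennreal (K * M) = ennreal K * variation_norm D f"
    using \<open>K > 0\<close> \<open>M > 0\<close> by (simp add: M ennreal_mult)
  ultimately show ?thesis unfolding K_def by simp
qed simp

end
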